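(* Let $K\ge 1$, weights $w_1,\dots,w_K>0$ with $\sum_i w_i=1$, features $x_1,\dots,x_K>0$, $h_i=x_i^2$, reals $u_0<c<b$, $0\le v_0<1$, $\lambda>0$, an integer $E\ge 2$, and a step size $\eta$ with $0<\eta\max\{h_1,\dots,h_K,\lambda\}<1$. Let $\rho_i(u)=\Phi(x_i(u-c))$, and consider the FedAvg process $(u_t^F,v_t^F)$, the pooled process $(u_t^P,v_t^P)$, the independent Local processes $(u_{i,t}^L,v_{i,t}^L)$, and the source-swapped process $(u_t^{\mathrm{swap}},v_t^{\mathrm{swap}})$ defined in the context, all started at $(u_0,v_0)$. Put $s_\eta(u)=\sum_i w_i(1-\eta\lambda\rho_i(u))^E$ and $\kappa_\eta(u)=-\frac{\partial}{\partial u}\log s_\eta(u)$. Then: (1) $u_t^F\le u_t^P$ and $v_t^F\le v_t^P$ for every round $t\ge 0$. (2) $\kappa_\eta(u)>0$ for every $u\in\mathbb{R}$, and for every $T\ge 1$, $$v_T^F\le v_T^{\mathrm{swap}}\le v_T^P,\qquad \log\frac{1-v_T^F}{1-v_T^{\mathrm{swap}}}=\sum_{t=0}^{T-1}\int_{u_t^F}^{u_t^P}\kappa_\eta(z)\,\mathrm{d}z .$$ (3) If in the losses each function $\rho_i$ is replaced by a model-independent constant $p_i\in[0,1]$ (possibly different for different clients), and all processes are redefined accordingly, then the source-swap difference is exactly zero: $v_T^F=v_T^{\mathrm{swap}}$ for every $T$. (4) With the original $\rho_i(u)=\Phi(x_i(u-c))$, the FedAvg iterates $(u_t^F,v_t^F)$,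 the pooled iterates $(u_t^P,v_t^P)$, and, for each $i$, the Local iterates $(u_{i,t}^L,v_{i,t}^L)$ converge as $t\to\infty$, monotonically in each coordinate, to the common optimum $(b,1)$.
   Context: $\Phi$ is the standard normal cumulative distribution function. For a learner $(u,v)\in\mathbb{R}^2$ and a source (generator) $\phi=(\phi_u,\phi_v)\in\mathbb{R}^2$, client $i$ has the fixed-source loss $$L_i((u,v);\phi)=\tfrac{h_i}{2}(u-b)^2+\tfrac{\lambda\rho_i(\phi_u)}{2}(v-1)^2 .$$ Its gradient is always taken in the learner argument $(u,v)$ only, with the source $\phi$ held fixed. One federated round with source $\phi$ from state $\theta\in\mathbb{R}^2$: each client $i$ starts at $\theta$ and performs $E$ gradient descent steps of size $\eta$ on $L_i(\cdot\,;\phi)$, reaching $\theta_{i,E}$; the new state is $\sum_i w_i\theta_{i,E}$. FedAvg process: $(u_{t+1}^F,v_{t+1}^F)$ is obtained from $(u_t^F,v_t^F)$ by one federated round with source $\phi=(u_t^F,v_t^F)$. Pooled process: $(u_{t+1}^P,v_{t+1}^P)$ is obtained from $(u_t^P,v_t^P)$ by $E$ gradient descent steps of size $\eta$ on $\sum_i w_iL_i(\cdot\,;\phi)$ with $\phi=(u_t^P,v_t^P)$ fixed during those $E$ steps. Local process of client $i$: $(u_{i,t+1}^L,v_{i,t+1}^L)$ is obtained from $(u_{i,t}^L,v_{i,t}^L)$ by $E$ gradient descent steps of size $\eta$ on $L_i(\cdot\,;\phi)$ with $\phi=(u_{i,t}^L,v_{i,t}^L)$ fixed during those $E$ steps (no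 averaging). Source-swapped process: $(u_{t+1}^{\mathrm{swap}},v_{t+1}^{\mathrm{swap}})$ is obtained from $(u_t^{\mathrm{swap}},v_t^{\mathrm{swap}})$ by one federated round whose source has first coordinate $\phi_u=u_t^P$, taken from the pooled process (the second coordinate of the source does not enter the loss). *)

theory Defs
  imports "HOL-Probability.Probability"
begin

definition std_normal_cdf :: "real \<Rightarrow> real" where
  "std_normal_cdf = cdf std_normal_distribution"

text \<open>The gradient is only meaningful where \<^term>\<open>f\<close> is differentiable; this holds at every point
  for the quadratic losses below.\<close>

definition grad :: "('a::real_inner \<Rightarrow> real) \<Rightarrow> 'a \<Rightarrow> 'a" where
  "grad f \<theta> = (THE D. GDERIV f \<theta> :> D)"

definition grad_descent :: "nat \<Rightarrow> real \<Rightarrow> ('a::real_inner \<Rightarrow> real) \<Rightarrow> 'a \<Rightarrow> 'a" where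
  "grad_descent E \<eta> f \<theta> = ((\<lambda>\<xi>. \<xi> - \<eta> *\<^sub>R grad f \<xi>) ^^ E) \<theta>"

text \<open>Clients are indexed by \<open>1..K\<close>; a model is a pair \<open>(u, v)\<close>.  In \<open>client_loss b lam h \<rho> i \<phi> \<theta>\<close>
  and in every loss family \<open>L i \<phi> \<theta>\<close> the source \<open>\<phi>\<close> comes before the learner \<open>\<theta>\<close>, so that
  \<open>grad (L i \<phi>)\<close> differentiates in the learner alone.\<close>

definition client_loss ::
  "real \<Rightarrow> real \<Rightarrow> (nat \<Rightarrow> real) \<Rightarrow> (nat \<Rightarrow> real \<Rightarrow> real) \<Rightarrow> nat \<Rightarrow> real \<times> real \<Rightarrow> real \<times> real \<Rightarrow> real" where
  "client_loss b lam h \<rho> i \<phi> \<theta> =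
     h i / 2 * (fst \<theta> - b)\<^sup>2 + lam * \<rho> i (fst \<phi>) / 2 * (snd \<theta> - 1)\<^sup>2"

definition fed_round ::
  "nat \<Rightarrow> (nat \<Rightarrow> real) \<Rightarrow> nat \<Rightarrow> real \<Rightarrow> (nat \<Rightarrow> real \<times> real \<Rightarrow> real \<times> real \<Rightarrow> real)
     \<Rightarrow> real \<times> real \<Rightarrow> real \<times> real \<Rightarrow> real \<times> real" where
  "fed_round K w E \<eta> L \<phi> \<theta> = (\<Sum>i=1..K. w i *\<^sub>R grad_descent E \<eta> (L i \<phi>) \<theta>)"

primrec fedavg ::
  "nat \<Rightarrow> (nat \<Rightarrow> real) \<Rightarrow> nat \<Rightarrow> real \<Rightarrow> (nat \<Rightarrow> real \<times> real \<Rightarrow> real \<times> real \<Rightarrow> real)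
     \<Rightarrow> real \<times> real \<Rightarrow> nat \<Rightarrow> real \<times> real" where
  "fedavg K w E \<eta> L \<theta>0 0 = \<theta>0"
| "fedavg K w E \<eta> L \<theta>0 (Suc t) =
     fed_round K w E \<eta> L (fedavg K w E \<eta> L \<theta>0 t) (fedavg K w E \<eta> L \<theta>0 t)"

primrec pooled ::
  "nat \<Rightarrow> (nat \<Rightarrow> real) \<Rightarrow> nat \<Rightarrow> real \<Rightarrow> (nat \<Rightarrow> real \<times> real \<Rightarrow> real \<times> real \<Rightarrow> real)
     \<Rightarrow> real \<times> real \<Rightarrow> nat \<Rightarrow> real \<times> real" where
  "pooled K w E \<eta> L \<theta>0 0 = \<theta>0"
| "pooled K w E \<eta> L \<theta>0 (Suc t) =
     grad_descent E \<eta> (\<lambda>\<theta>. \<Sum>i=1..K. w i * L i (pooled K w E \<eta> L \<theta>0 t) \<theta>) (pooled K w E \<eta> L \<theta>0 t)"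

primrec local_process ::
  "nat \<Rightarrow> real \<Rightarrow> (nat \<Rightarrow> real \<times> real \<Rightarrow> real \<times> real \<Rightarrow> real)
     \<Rightarrow> real \<times> real \<Rightarrow> nat \<Rightarrow> nat \<Rightarrow> real \<times> real" where
  "local_process E \<eta> L \<theta>0 i 0 = \<theta>0"
| "local_process E \<eta> L \<theta>0 i (Suc t) =
     grad_descent E \<eta> (L i (local_process E \<eta> L \<theta>0 i t)) (local_process E \<eta> L \<theta>0 i t)"

text \<open>The source is the whole pooled state; its second coordinate does not enter \<^const>\<open>client_loss\<close>.\<close>

primrec source_swapped ::
  "nat \<Rightarrow> (nat \<Rightarrow> real) \<Rightarrow> nat \<Rightarrow> real \<Rightarrow> (nat \<Rightarrow> real \<times> real \<Rightarrow> real \<times> real \<Rightarrow> real)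
     \<Rightarrow> real \<times> real \<Rightarrow> nat \<Rightarrow> real \<times> real" where
  "source_swapped K w E \<eta> L \<theta>0 0 = \<theta>0"
| "source_swapped K w E \<eta> L \<theta>0 (Suc t) =
     fed_round K w E \<eta> L (pooled K w E \<eta> L \<theta>0 t) (source_swapped K w E \<eta> L \<theta>0 t)"

definition s_eta ::
  "nat \<Rightarrow> (nat \<Rightarrow> real) \<Rightarrow> nat \<Rightarrow> real \<Rightarrow> real \<Rightarrow> (nat \<Rightarrow> real \<Rightarrow> real) \<Rightarrow> real \<Rightarrow> real" where
  "s_eta K w E \<eta> lam \<rho> u = (\<Sum>i=1..K. w i * (1 - \<eta> * lam * \<rho> i u) ^ E)"

definition kappa_eta ::
  "nat \<Rightarrow> (nat \<Rightarrow> real) \<Rightarrow> nat \<Rightarrow> real \<Rightarrow> real \<Rightarrow> (nat \<Rightarrow> real \<Rightarrow> real) \<Rightarrow> real \<Rightarrow> real" where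
  "kappa_eta K w E \<eta> lam \<rho> u = - deriv (\<lambda>z. ln (s_eta K w E \<eta> lam \<rho> z)) u"

end

theory Submission
  imports Defs
begin

text \<open>Gradient descent on a separable quadratic is explicit, so every process is a skew recurrence:
  \<open>b - u\<close> is multiplied by a constant factor, and \<open>1 - v\<close> by a factor depending on the first
  coordinate of the source, namely \<open>s\<^sub>\<eta>\<close> for a federated round and
  \<open>(1 - \<eta> \<lambda> \<Sum>\<^sub>i w\<^sub>i \<rho>\<^sub>i)^E\<close> for a pooled round. Jensen's inequality for the \<open>E\<close>-th
  power makes the pooled factors the smaller ones, and \<open>s\<^sub>\<eta>\<close> is strictly decreasing, so that the
  lagging FedAvg source yields the larger factors. The two federated products differ by ratios
  \<open>s\<^sub>\<eta>(u\<^sup>F) / s\<^sub>\<eta>(u\<^sup>P)\<close>, whose logarithms are integrals of \<open>\<kappa>\<^sub>\<eta>\<close>.\<close>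

section \<open>The normal distribution function\<close>

text \<open>The increment is the mass of \<open>{a<..y}\<close>. Writing it as an interval integral
  with finite lower limit makes the fundamental theorem of calculus applicable.\<close>

lemma std_normal_cdf_diff:
  assumes "a \<le> y"
  shows "std_normal_cdf y - std_normal_cdf a = (LBINT t=a..y. std_normal_density t)"
proof (cases "a = y")
  case True
  then show ?thesis by simp
next
  case False
  interpret real_distribution std_normal_distribution
    by (rule real_dist_normal_dist)
  have "std_normal_cdf y - std_normal_cdf a = measure std_normal_distribution {a<..y}"
    using False assms by (simp add: std_normal_cdf_def cdf_diff_eq)
  also have "\<dots> = enn2real (\<integral>\<^sup>+ t. ennreal (indicator {a<..y} t * std_normal_density t) \<partial>lborel)"
    by (simp add: measure_def emeasure_density ennreal_mult' ennreal_indicator mult.commute)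
  also have "\<dots> = (LINT t|lborel. indicator {a<..y} t * std_normal_density t)"
    by (intro integral_eq_nn_integral[symmetric]) auto
  also have "\<dots> = (LBINT t=a..y. std_normal_density t)"
    using assms by (simp add: interval_integral_Ioc set_lebesgue_integral_def)
  finally show ?thesis .
qed

lemma continuous_on_std_normal_density: "continuous_on A std_normal_density"
  unfolding std_normal_density_def by (intro continuous_intros) auto

lemma DERIV_std_normal_cdf: "(std_normal_cdf has_real_derivative std_normal_density y) (at y)"
proof -
  \<comment> \<open>A window around \<open>y\<close> keeps \<open>y\<close> in its interior, so the
    derivative within the window is a full derivative.\<close>
  let ?I = "{y - 1..y + 1}"
  have "((\<lambda>z. LBINT t=y - 1..z. std_normal_density t)
      has_vector_derivative std_normal_density y) (at y within ?I)"
    by (rule interval_integral_FTC2) (auto intro: continuous_on_std_normal_density)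
  then have deriv: "((\<lambda>z. std_normal_cdf (y - 1) + (LBINT t=y - 1..z. std_normal_density t))
      has_real_derivative std_normal_density y) (at y within ?I)"
    by (intro DERIV_cong[OF DERIV_add[OF DERIV_const]])
      (simp_all add: has_real_derivative_iff_has_vector_derivative)
  have "std_normal_cdf (y - 1) + (LBINT t=y - 1..z. std_normal_density t) = std_normal_cdf z"
    if "z \<in> ?I" for z
    using std_normal_cdf_diff[of "y - 1" z] that by (auto simp: algebra_simps)
  then have "(std_normal_cdf has_real_derivative std_normal_density y) (at y within ?I)"
    by (intro has_field_derivative_transform_within[OF deriv zero_less_one]) simp_all
  then show ?thesis
    by (simp add: at_within_Icc_at)
qed

lemma std_normal_cdf_strict_mono: "y < z \<Longrightarrow> std_normal_cdf y < std_normal_cdf z"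
  by (rule DERIV_pos_imp_increasing) (auto intro!: exI conjI DERIV_std_normal_cdf normal_density_pos)

lemma std_normal_cdf_le_1: "std_normal_cdf y \<le> 1"
proof -
  interpret real_distribution std_normal_distribution
    by (rule real_dist_normal_dist)
  show ?thesis by (simp add: std_normal_cdf_def cdf_bounded_prob)
qed

text \<open>Strict growth from \<open>y - 1\<close> to \<open>y\<close> upgrades nonnegativity to
  positivity.\<close>

lemma std_normal_cdf_pos: "0 < std_normal_cdf y"
proof -
  interpret real_distribution std_normal_distribution
    by (rule real_dist_normal_dist)
  have "0 \<le> std_normal_cdf (y - 1)"
    by (simp add: std_normal_cdf_def cdf_nonneg)
  with std_normal_cdf_strict_mono[of "y - 1" y] show ?thesis by simp
qed

section \<open>Gradient descent on separable quadratics\<close>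

text \<open>\<open>grad\<close> is a definite description, so evaluating it needs uniqueness,
  inherited from uniqueness of the Frechet derivative.\<close>

lemma grad_eqI:
  assumes "GDERIV f \<theta> :> D"
  shows "grad f \<theta> = D"
  unfolding grad_def
proof (rule the_equality)
  fix D' assume "GDERIV f \<theta> :> D'"
  then have "(\<lambda>k. inner k D') = (\<lambda>k. inner k D)"
    using assms has_derivative_unique unfolding gderiv_def by blast
  \<comment> \<open>Evaluate both functionals at the vector \<open>D' - D\<close>.\<close>
  then have "inner (D' - D) (D' - D) = 0"
    by (metis inner_diff_right right_minus_eq)
  then show "D' = D" by simp
qed (fact assms)

lemma grad_quadratic:
  fixes \<theta> :: "real \<times> real"
  shows "grad (\<lambda>\<xi>. a / 2 * (fst \<xi> - p)\<^sup>2 + m / 2 * (snd \<xi> - q)\<^sup>2) \<theta>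
    = (a * (fst \<theta> - p), m * (snd \<theta> - q))"
proof (rule grad_eqI)
  let ?f = "\<lambda>\<xi>. a / 2 * (fst \<xi> - p)\<^sup>2 + m / 2 * (snd \<xi> - q)\<^sup>2"
  have "(?f has_derivative (\<lambda>k. a * (fst \<theta> - p) * fst k + m * (snd \<theta> - q) * snd k)) (at \<theta>)"
    by (rule has_derivative_eq_rhs, (rule derivative_eq_intros refl)+)
      (auto simp: fun_eq_iff field_simps)
  then show "GDERIV ?f \<theta> :> (a * (fst \<theta> - p), m * (snd \<theta> - q))"
    by (simp add: gderiv_def inner_prod_def mult.commute)
qed

text \<open>The coordinates decouple: each step scales the two distances to \<open>(p, q)\<close> by
  \<open>1 - \<eta> * a\<close> and \<open>1 - \<eta> * m\<close>.\<close>

lemma grad_descent_quadratic: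
  fixes \<theta> :: "real \<times> real"
  shows "grad_descent n \<eta> (\<lambda>\<xi>. a / 2 * (fst \<xi> - p)\<^sup>2 + m / 2 * (snd \<xi> - q)\<^sup>2) \<theta>
    = (p - (1 - \<eta> * a) ^ n * (p - fst \<theta>), q - (1 - \<eta> * m) ^ n * (q - snd \<theta>))"
  unfolding grad_descent_def grad_quadratic
  by (induction n) (auto simp: algebra_simps)

lemma grad_descent_client_loss:
  "grad_descent n \<eta> (client_loss b lam h \<rho> i \<phi>) \<theta>
    = (b - (1 - \<eta> * h i) ^ n * (b - fst \<theta>), 1 - (1 - \<eta> * (lam * \<rho> i (fst \<phi>))) ^ n * (1 - snd \<theta>))"
  unfolding grad_descent_quadratic[symmetric] client_loss_def by (rule refl)

text \<open>All client losses share the centre \<open>(b, 1)\<close>, so their mixture is one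
  quadratic with averaged curvatures. The average is taken before the power.\<close>

lemma grad_descent_pooled_loss:
  "grad_descent n \<eta> (\<lambda>\<theta>. \<Sum>i=1..K. w i * client_loss b lam h \<rho> i \<phi> \<theta>) \<theta>
    = (b - (1 - \<eta> * (\<Sum>i=1..K. w i * h i)) ^ n * (b - fst \<theta>),
       1 - (1 - \<eta> * (lam * (\<Sum>i=1..K. w i * \<rho> i (fst \<phi>)))) ^ n * (1 - snd \<theta>))"
proof -
  have "(\<lambda>\<theta>. \<Sum>i=1..K. w i * client_loss b lam h \<rho> i \<phi> \<theta>)
      = (\<lambda>\<theta>. (\<Sum>i=1..K. w i * h i) / 2 * (fst \<theta> - b)\<^sup>2
          + (lam * (\<Sum>i=1..K. w i * \<rho> i (fst \<phi>))) / 2 * (snd \<theta> - 1)\<^sup>2)"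
    by (simp add: client_loss_def fun_eq_iff sum_divide_distrib sum_distrib_left sum_distrib_right
        flip: sum.distrib) (simp add: field_simps)
  then show ?thesis by (simp only: grad_descent_quadratic)
qed

text \<open>Weights summing to 1 leave the centre \<open>(b, 1)\<close> in place and average the
  client factors after the power.\<close>

lemma fed_round_client_loss:
  assumes "(\<Sum>i=1..K. w i) = 1"
  shows "fed_round K w E \<eta> (client_loss b lam h \<rho>) \<phi> \<theta>
    = (b - (\<Sum>i=1..K. w i * (1 - \<eta> * h i) ^ E) * (b - fst \<theta>),
       1 - s_eta K w E \<eta> lam \<rho> (fst \<phi>) * (1 - snd \<theta>))"
proof -
  have "(\<Sum>i=1..K. w i * (p - g i * r)) = p - (\<Sum>i=1..K. w i * g i) * r" for p r :: real and g
  proof -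
    have "(\<Sum>i=1..K. w i * (p - g i * r)) = (\<Sum>i=1..K. w i) * p - (\<Sum>i=1..K. w i * g i) * r"
      by (simp add: sum_distrib_left sum_subtractf algebra_simps)
    then show ?thesis by (simp only: assms mult_1_left)
  qed
  then show ?thesis
    by (simp add: fed_round_def grad_descent_client_loss s_eta_def prod_eq_iff fst_sum snd_sum
        mult.assoc)
qed

text \<open>With constant \<open>\<rho>\<close> the loss ignores its source, so both recursions
  iterate the same round map.\<close>

lemma fedavg_eq_source_swapped_const:
  "fedavg K w E \<eta> (client_loss b lam h (\<lambda>i _. p i)) \<theta>0 T
    = source_swapped K w E \<eta> (client_loss b lam h (\<lambda>i _. p i)) \<theta>0 T"
proof -
  have "fed_round K w E \<eta> (client_loss b lam h (\<lambda>i _. p i)) \<phi>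
      = fed_round K w E \<eta> (client_loss b lam h (\<lambda>i _. p i)) \<phi>'" for \<phi> \<phi>'
    by (simp only: fed_round_def[abs_def] client_loss_def[abs_def])
  from fun_cong[OF this] show ?thesis
    by (induction T) (simp_all only: fedavg.simps source_swapped.simps)
qed

text \<open>This justifies calling \<open>(b, 1)\<close> the common optimum: both curvatures are
  positive, so the minimiser is unique and the same for every client and source.\<close>

lemma is_arg_min_client_loss:
  assumes "h i > 0" "lam * \<rho> i (fst \<phi>) > 0"
  shows "is_arg_min (client_loss b lam h \<rho> i \<phi>) (\<lambda>_. True) \<theta> \<longleftrightarrow> \<theta> = (b, 1)"
proof -
  have zero: "client_loss b lam h \<rho> i \<phi> (b, 1) = 0"
    by (simp add: client_loss_def)
  have nonneg: "client_loss b lam h \<rho> i \<phi> \<xi> \<ge> 0" for \<xi>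
    using assms by (simp add: client_loss_def)
  have pos: "client_loss b lam h \<rho> i \<phi> \<xi> > 0" if "\<xi> \<noteq> (b, 1)" for \<xi>
  proof (cases "fst \<xi> = b")
    case True
    then have "snd \<xi> \<noteq> 1" using that by (auto simp: prod_eq_iff)
    then show ?thesis using assms True by (simp add: client_loss_def)
  next
    case False
    then show ?thesis using assms by (auto simp: client_loss_def intro!: add_pos_nonneg)
  qed
  show ?thesis
    unfolding is_arg_min_linorder using zero nonneg pos[of \<theta>] by (metis not_le)
qed

lemma Jensen_power:
  fixes y :: "nat \<Rightarrow> real"
  assumes "finite I" "I \<noteq> {}" "(\<Sum>i\<in>I. w i) = 1" "\<And>i. i \<in> I \<Longrightarrow> w i \<ge> 0" "\<And>i. i \<in> I \<Longrightarrow> y i \<ge> 0"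
  shows "(\<Sum>i\<in>I. w i * y i) ^ n \<le> (\<Sum>i\<in>I. w i * y i ^ n)"
proof -
  \<comment> \<open>Even powers are convex on the whole line, odd ones in general only on the
    half-line, hence the case split.\<close>
  have "convex_on {0::real..} (\<lambda>x. x ^ n)"
    using convex_power_even convex_power_odd by (cases "even n") (auto intro: convex_on_subset)
  from convex_on_sum[OF assms(1,2) this assms(3,4), of y] assms(5) show ?thesis by simp
qed

section \<open>Skew recurrences\<close>

text \<open>The common bound \<open>r < 1\<close> gives domination by \<open>r ^ t * d 0\<close>.
  Factors merely below 1 would not suffice, since their infinite product may be positive.\<close>

lemma tendsto_zero_contraction:
  fixes d q :: "nat \<Rightarrow> real"
  assumes "\<And>t. d (Suc t) = q t * d t" "\<And>t. 0 \<le> q t" "\<And>t. q t \<le> r" "r < 1" "0 \<le> d 0"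
  shows "d \<longlonglongrightarrow> 0" "decseq d"
proof -
  have r: "0 \<le> r" using assms(2,3)[of 0] by linarith
  have nonneg: "0 \<le> d t" for t
    by (induction t) (auto simp: assms)
  have "d t \<le> r ^ t * d 0" for t
  proof (induction t)
    case (Suc t)
    have "q t * d t \<le> r * (r ^ t * d 0)"
      by (rule mult_mono[OF assms(3) Suc r nonneg])
    then show ?case by (simp add: assms(1) mult.assoc)
  qed simp
  moreover have "(\<lambda>t. r ^ t * d 0) \<longlonglongrightarrow> 0"
    using r assms(4) by (intro tendsto_mult_left_zero LIMSEQ_power_zero) simp
  ultimately show "d \<longlonglongrightarrow> 0"
    using nonneg by (intro tendsto_sandwich[of "\<lambda>_. 0" d _ "\<lambda>t. r ^ t * d 0"]) auto
  show "decseq d"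
  proof (intro decseq_SucI)
    fix t
    have "q t \<le> 1" using assms(3)[of t] assms(4) by simp
    then show "d (Suc t) \<le> d t"
      using nonneg[of t] mult_right_mono[of "q t" 1 "d t"] by (simp add: assms(1))
  qed
qed

text \<open>The first coordinate evolves on its own and drives the factor of the second. It
  increases, so the antimonotone \<open>g\<close> never exceeds its initial value, which serves as
  the uniform contraction bound.\<close>

lemma skew_recurrence_converges:
  fixes z :: "nat \<Rightarrow> real \<times> real"
  assumes step: "\<And>t. z (Suc t) = (b - A * (b - fst (z t)), 1 - g (fst (z t)) * (1 - snd (z t)))"
    and A: "0 \<le> A" "A < 1" and g: "antimono g" "\<And>u. 0 \<le> g u" "g (fst (z 0)) < 1"
    and init: "fst (z 0) \<le> b" "snd (z 0) \<le> 1"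
  shows "z \<longlonglongrightarrow> (b, 1)" "incseq (\<lambda>t. fst (z t))" "incseq (\<lambda>t. snd (z t))"
proof -
  have u: "(\<lambda>t. b - fst (z t)) \<longlonglongrightarrow> 0" "decseq (\<lambda>t. b - fst (z t))"
    by (rule tendsto_zero_contraction[where q = "\<lambda>_. A" and r = A]; use A init in \<open>simp add: step\<close>)+
  then show mono_u: "incseq (\<lambda>t. fst (z t))"
    by (simp add: monotone_on_def)
  have "fst (z 0) \<le> fst (z t)" for t
    using incseqD[OF mono_u, of 0 t] by simp
  then have le: "g (fst (z t)) \<le> g (fst (z 0))" for t
    using g(1) by (simp add: antimonoD)
  have v: "(\<lambda>t. 1 - snd (z t)) \<longlonglongrightarrow> 0" "decseq (\<lambda>t. 1 - snd (z t))"
    by (rule tendsto_zero_contraction[where q = "\<lambda>t. g (fst (z t))" and r = "g (fst (z 0))"];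
        use le g init in \<open>simp add: step\<close>)+
  then show "incseq (\<lambda>t. snd (z t))"
    by (simp add: monotone_on_def)
  have "(\<lambda>t. (b - (b - fst (z t)), 1 - (1 - snd (z t)))) \<longlonglongrightarrow> (b - 0, 1 - 0)"
    using u(1) v(1) by (intro tendsto_intros)
  then show "z \<longlonglongrightarrow> (b, 1)" by simp
qed

lemma geometric_closed_form:
  fixes z :: "nat \<Rightarrow> real"
  assumes "\<And>t. z (Suc t) = a - q t * (a - z t)"
  shows "a - z t = (\<Prod>j<t. q j) * (a - z 0)"
  by (induction t) (auto simp: assms)

section \<open>The four processes\<close>

text \<open>The normal link enters only through these properties of \<open>\<rho>\<close>. Its
  derivative \<open>\<rho>'\<close> is a parameter because its sign gives
  \<open>\<kappa> > 0\<close> and its continuity allows integrating \<open>\<kappa>\<close>.\<close>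

locale feature_federation =
  fixes K E :: nat and w h :: "nat \<Rightarrow> real" and b lam \<eta> :: real
    and \<rho> \<rho>' :: "nat \<Rightarrow> real \<Rightarrow> real" and u0 v0 :: real
  assumes K: "K \<ge> 1" and E: "E \<ge> 1"
    and w_pos: "\<And>i. i \<in> {1..K} \<Longrightarrow> 0 < w i" and w_sum: "(\<Sum>i=1..K. w i) = 1"
    and \<eta>: "0 < \<eta>" and lam: "0 < lam" "\<eta> * lam < 1"
    and h: "\<And>i. i \<in> {1..K} \<Longrightarrow> 0 < h i" "\<And>i. i \<in> {1..K} \<Longrightarrow> \<eta> * h i < 1"
    and \<rho>_pos: "\<And>i u. i \<in> {1..K} \<Longrightarrow> 0 < \<rho> i u" and \<rho>_le_1: "\<And>i u. i \<in> {1..K} \<Longrightarrow> \<rho> i u \<le> 1"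
    and \<rho>_deriv: "\<And>i u. i \<in> {1..K} \<Longrightarrow> (\<rho> i has_real_derivative \<rho>' i u) (at u)"
    and \<rho>'_pos: "\<And>i u. i \<in> {1..K} \<Longrightarrow> 0 < \<rho>' i u"
    and \<rho>'_cont: "\<And>i. i \<in> {1..K} \<Longrightarrow> continuous_on UNIV (\<rho>' i)"
    and u0: "u0 < b" and v0: "v0 < 1"
begin

abbreviation "L \<equiv> client_loss b lam h \<rho>"
abbreviation "F \<equiv> fedavg K w E \<eta> L (u0, v0)"
abbreviation "P \<equiv> pooled K w E \<eta> L (u0, v0)"
abbreviation "S \<equiv> source_swapped K w E \<eta> L (u0, v0)"
abbreviation "Loc \<equiv> local_process E \<eta> L (u0, v0)"
abbreviation "s \<equiv> s_eta K w E \<eta> lam \<rho>"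
abbreviation "\<kappa> \<equiv> kappa_eta K w E \<eta> lam \<rho>"

text \<open>Per-round factors of the error \<open>b - u\<close> are \<open>A\<close> (federated) and
  \<open>B\<close> (pooled); \<open>r\<close> is the pooled factor of \<open>1 - v\<close>, the
  counterpart of \<open>s\<close>. The termwise derivative of \<open>s\<close> is
  \<open>s'\<close>.\<close>

definition "A = (\<Sum>i=1..K. w i * (1 - \<eta> * h i) ^ E)"
definition "B = (1 - \<eta> * (\<Sum>i=1..K. w i * h i)) ^ E"
definition "r u = (1 - \<eta> * (lam * (\<Sum>i=1..K. w i * \<rho> i u))) ^ E"
definition "s' u = (\<Sum>i=1..K. w i * (real E * (1 - \<eta> * lam * \<rho> i u) ^ (E - 1) * - (\<eta> * lam * \<rho>' i u)))"

lemma F_Suc: "F (Suc t) = (b - A * (b - fst (F t)), 1 - s (fst (F t)) * (1 - snd (F t)))"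
  by (simp add: fed_round_client_loss[OF w_sum] A_def)

lemma S_Suc: "S (Suc t) = (b - A * (b - fst (S t)), 1 - s (fst (P t)) * (1 - snd (S t)))"
  by (simp add: fed_round_client_loss[OF w_sum] A_def)

lemma P_Suc: "P (Suc t) = (b - B * (b - fst (P t)), 1 - r (fst (P t)) * (1 - snd (P t)))"
  by (simp add: grad_descent_pooled_loss B_def r_def del: One_nat_def)

lemma Loc_Suc: "Loc i (Suc t) = (b - (1 - \<eta> * h i) ^ E * (b - fst (Loc i t)),
    1 - (1 - \<eta> * (lam * \<rho> i (fst (Loc i t)))) ^ E * (1 - snd (Loc i t)))"
  by (simp add: grad_descent_client_loss)

section \<open>Bounds, ordering and monotonicity of the contraction factors\<close>

lemma \<eta>_lam_\<rho>: "0 < \<eta> * lam * \<rho> i u" "\<eta> * lam * \<rho> i u < 1" if "i \<in> {1..K}"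
proof -
  show "0 < \<eta> * lam * \<rho> i u" using \<eta> lam \<rho>_pos[OF that] by simp
  have "\<eta> * lam * \<rho> i u \<le> \<eta> * lam * 1"
    using \<eta> lam \<rho>_le_1[OF that] by (intro mult_left_mono) auto
  then show "\<eta> * lam * \<rho> i u < 1" using lam by simp
qed

lemma \<rho>_mono: "\<rho> i u \<le> \<rho> i u'" if "i \<in> {1..K}" "u \<le> u'"
  by (rule DERIV_nonneg_imp_nondecreasing[OF that(2)])
     (use \<rho>_deriv[OF that(1)] \<rho>'_pos[OF that(1)] less_imp_le in blast)

lemma weighted_mean_bounds:
  assumes "\<And>i. i \<in> {1..K} \<Longrightarrow> 0 < y i" "\<And>i. i \<in> {1..K} \<Longrightarrow> y i < (1::real)"
  shows "0 < (\<Sum>i=1..K. w i * y i)" "(\<Sum>i=1..K. w i * y i) < 1"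
proof -
  show "0 < (\<Sum>i=1..K. w i * y i)"
    using K assms w_pos by (intro sum_pos) auto
  have "(\<Sum>i=1..K. w i * y i) < (\<Sum>i=1..K. w i * 1)"
    using K assms w_pos by (intro sum_strict_mono mult_strict_left_mono) auto
  then show "(\<Sum>i=1..K. w i * y i) < 1" using w_sum by simp
qed

lemma weighted_mean_compl: "(\<Sum>i=1..K. w i * (1 - c * y i)) = 1 - c * (\<Sum>i=1..K. w i * y i)"
  using w_sum by (simp add: sum_subtractf sum_distrib_left algebra_simps)

lemma one_minus_power:
  fixes y :: real
  assumes "0 < y" "y < 1"
  shows "0 < (1 - y) ^ E" "(1 - y) ^ E < 1"
  \<comment> \<open>The exponent is \<open>Suc (E - 1)\<close>; with \<open>E = 0\<close> the power
    would be 1 and the strict bound would fail.\<close>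
  using assms E power_Suc_less_one[of "1 - y" "E - 1"] by simp_all

lemma A_bounds: "0 < A" "A < 1"
  unfolding A_def by (rule weighted_mean_bounds; use one_minus_power \<eta> h in simp)+

lemma s_bounds: "0 < s u" "s u < 1"
  unfolding s_eta_def by (rule weighted_mean_bounds; use one_minus_power \<eta>_lam_\<rho> in simp)+

lemma B_bounds: "0 < B" "B < 1"
proof -
  have "0 < (\<Sum>i=1..K. w i * (\<eta> * h i))" "(\<Sum>i=1..K. w i * (\<eta> * h i)) < 1"
    by (rule weighted_mean_bounds; use \<eta> h in simp)+
  then show "0 < B" "B < 1"
    using one_minus_power[of "\<eta> * (\<Sum>i=1..K. w i * h i)"]
    by (simp_all add: B_def sum_distrib_left mult_ac)
qed

lemma r_bounds: "0 < r u" "r u < 1"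
proof -
  have "0 < (\<Sum>i=1..K. w i * (\<eta> * lam * \<rho> i u))" "(\<Sum>i=1..K. w i * (\<eta> * lam * \<rho> i u)) < 1"
    by (rule weighted_mean_bounds; use \<eta>_lam_\<rho> in simp)+
  then show "0 < r u" "r u < 1"
    using one_minus_power[of "\<eta> * (lam * (\<Sum>i=1..K. w i * \<rho> i u))"]
    by (simp_all add: r_def sum_distrib_left mult_ac)
qed

text \<open>Jensen: the power of the averaged client factor is at most the average of the
  powers.\<close>

lemma B_le_A: "B \<le> A"
proof -
  have "(\<Sum>i=1..K. w i * (1 - \<eta> * h i)) ^ E \<le> A"
    unfolding A_def
    by (rule Jensen_power) (use K w_sum w_pos h in \<open>auto simp: less_imp_le\<close>)
  then show ?thesis by (simp only: B_def weighted_mean_compl)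
qed

lemma r_eq: "r u = (\<Sum>i=1..K. w i * (1 - \<eta> * lam * \<rho> i u)) ^ E"
  by (simp only: r_def weighted_mean_compl) (simp add: mult.assoc)

text \<open>The same Jensen comparison for the second coordinate, at one common source.\<close>

lemma r_le_s: "r u \<le> s u"
  unfolding r_eq s_eta_def
  by (rule Jensen_power) (use K w_sum w_pos \<eta>_lam_\<rho> in \<open>auto simp: less_imp_le\<close>)

text \<open>A larger source coordinate raises \<open>\<rho> i\<close>, lowering a base that stays
  positive.\<close>

lemma antimono_client_factor: "antimono (\<lambda>u. (1 - \<eta> * lam * \<rho> i u) ^ E)" if "i \<in> {1..K}"
  using that \<eta> lam \<rho>_mono \<eta>_lam_\<rho>
  by (intro antimonoI power_mono) (auto simp: less_imp_le)

lemma antimono_s: "antimono s"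
  using antimonoD[OF antimono_client_factor] w_pos
  by (intro antimonoI) (auto simp: s_eta_def less_imp_le intro!: sum_mono mult_left_mono)

lemma antimono_r: "antimono r"
proof (intro antimonoI)
  fix u u' :: real assume "u \<le> u'"
  have "(\<Sum>i=1..K. w i * (1 - \<eta> * lam * \<rho> i u')) \<le> (\<Sum>i=1..K. w i * (1 - \<eta> * lam * \<rho> i u))"
    using \<open>u \<le> u'\<close> \<eta> lam \<rho>_mono w_pos by (intro sum_mono mult_left_mono) (auto simp: less_imp_le)
  moreover have "0 \<le> (\<Sum>i=1..K. w i * (1 - \<eta> * lam * \<rho> i u'))"
    using w_pos \<eta>_lam_\<rho> by (intro sum_nonneg mult_nonneg_nonneg) (auto simp: less_imp_le)
  ultimately show "r u' \<le> r u"
    unfolding r_eq by (rule power_mono)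
qed

section \<open>Monotone convergence to the optimum\<close>

lemma F_converges: "F \<longlonglongrightarrow> (b, 1)" "incseq (\<lambda>t. fst (F t))" "incseq (\<lambda>t. snd (F t))"
  by (rule skew_recurrence_converges[where z = F and g = s, OF F_Suc];
      use A_bounds s_bounds antimono_s u0 v0 in \<open>simp add: less_imp_le\<close>)+

lemma P_converges: "P \<longlonglongrightarrow> (b, 1)" "incseq (\<lambda>t. fst (P t))" "incseq (\<lambda>t. snd (P t))"
  by (rule skew_recurrence_converges[where z = P and g = r, OF P_Suc];
      use B_bounds r_bounds antimono_r u0 v0 in \<open>simp add: less_imp_le\<close>)+

lemma Loc_converges:
  assumes "i \<in> {1..K}"
  shows "Loc i \<longlonglongrightarrow> (b, 1)" "incseq (\<lambda>t. fst (Loc i t))" "incseq (\<lambda>t. snd (Loc i t))"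
proof -
  have bounds: "0 < (1 - \<eta> * h i) ^ E" "(1 - \<eta> * h i) ^ E < 1"
    "0 < (1 - \<eta> * (lam * \<rho> i u)) ^ E" "(1 - \<eta> * (lam * \<rho> i u)) ^ E < 1" for u
    using one_minus_power[of "\<eta> * h i"] one_minus_power[of "\<eta> * lam * \<rho> i u"]
      \<eta> h[OF assms] \<eta>_lam_\<rho>[OF assms] by (simp_all add: mult.assoc)
  have anti: "antimono (\<lambda>u. (1 - \<eta> * (lam * \<rho> i u)) ^ E)"
    using antimono_client_factor[OF assms] by (simp add: mult.assoc)
  show "Loc i \<longlonglongrightarrow> (b, 1)" "incseq (\<lambda>t. fst (Loc i t))" "incseq (\<lambda>t. snd (Loc i t))"
    by (rule skew_recurrence_converges[where z = "Loc i"
          and g = "\<lambda>u. (1 - \<eta> * (lam * \<rho> i u)) ^ E", OF Loc_Suc];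
        use bounds anti u0 v0 in \<open>simp add: less_imp_le\<close>)+
qed

section \<open>Closed forms and comparison of the processes\<close>

lemma F_closed: "b - fst (F t) = A ^ t * (b - u0)" "1 - snd (F t) = (\<Prod>j<t. s (fst (F j))) * (1 - v0)"
  using geometric_closed_form[of "\<lambda>t. fst (F t)" b "\<lambda>_. A" t]
    geometric_closed_form[of "\<lambda>t. snd (F t)" 1 "\<lambda>t. s (fst (F t))" t]
  by (simp_all add: F_Suc del: fedavg.simps(2))

lemma P_closed: "b - fst (P t) = B ^ t * (b - u0)" "1 - snd (P t) = (\<Prod>j<t. r (fst (P j))) * (1 - v0)"
  using geometric_closed_form[of "\<lambda>t. fst (P t)" b "\<lambda>_. B" t]
    geometric_closed_form[of "\<lambda>t. snd (P t)" 1 "\<lambda>t. r (fst (P t))" t]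
  by (simp_all add: P_Suc del: pooled.simps(2))

lemma S_closed: "1 - snd (S t) = (\<Prod>j<t. s (fst (P j))) * (1 - v0)"
  using geometric_closed_form[of "\<lambda>t. snd (S t)" 1 "\<lambda>t. s (fst (P t))" t]
  by (simp add: S_Suc del: source_swapped.simps(2))

text \<open>Both gaps to \<open>b\<close> are geometric with the same positive start, with ratios
  ordered by \<open>B_le_A\<close>.\<close>

lemma fst_F_le_P: "fst (F t) \<le> fst (P t)"
proof -
  have "B ^ t * (b - u0) \<le> A ^ t * (b - u0)"
    using B_le_A B_bounds u0 by (intro mult_right_mono power_mono) auto
  then show ?thesis using F_closed(1)[of t] P_closed(1)[of t] by linarith
qed

text \<open>This isolates the source effect: the two products differ only in where \<open>s\<close>
  is evaluated, and \<open>s\<close> is larger at the lagging FedAvg source.\<close>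

lemma snd_F_le_S: "snd (F t) \<le> snd (S t)"
proof -
  have "(\<Prod>j<t. s (fst (P j))) * (1 - v0) \<le> (\<Prod>j<t. s (fst (F j))) * (1 - v0)"
    using s_bounds v0 antimono_s fst_F_le_P
    by (intro mult_right_mono prod_mono) (auto simp: less_imp_le dest: antimonoD)
  then show ?thesis using F_closed(2)[of t] S_closed[of t] by linarith
qed

text \<open>This isolates the averaging effect: the sources agree, and only \<open>r\<close> versus
  \<open>s\<close> differs.\<close>

lemma snd_S_le_P: "snd (S t) \<le> snd (P t)"
proof -
  have "(\<Prod>j<t. r (fst (P j))) * (1 - v0) \<le> (\<Prod>j<t. s (fst (P j))) * (1 - v0)"
    using r_bounds v0 r_le_s by (intro mult_right_mono prod_mono) (auto simp: less_imp_le)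
  then show ?thesis using P_closed(2)[of t] S_closed[of t] by linarith
qed

text \<open>Needed so that the quotient in the logarithmic identity is a quotient of positive
  numbers.\<close>

lemma snd_less_1: "snd (F t) < 1" "snd (S t) < 1"
proof -
  have "0 < (\<Prod>j<t. s (f j)) * (1 - v0)" for f
    using s_bounds v0 by (simp add: prod_pos)
  then show "snd (F t) < 1" "snd (S t) < 1"
    using F_closed(2)[of t] S_closed[of t] by (metis diff_gt_0_iff_gt)+
qed

section \<open>The logarithmic derivative and the exact source-swap gap\<close>

lemma DERIV_s: "(s has_real_derivative s' u) (at u)"
  unfolding s_eta_def[abs_def] s'_def
  by (rule DERIV_sum, rule DERIV_cmult)
     (rule derivative_eq_intros \<rho>_deriv refl | assumption | simp)+

text \<open>Each client contributes a strictly negative term, and there is at least one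
  client.\<close>

lemma s'_neg: "s' u < 0"
proof -
  have "0 < (\<Sum>i=1..K. w i * (real E * (1 - \<eta> * lam * \<rho> i u) ^ (E - 1) * (\<eta> * lam * \<rho>' i u)))"
    using K E w_pos \<eta> lam \<eta>_lam_\<rho> \<rho>'_pos by (intro sum_pos mult_pos_pos zero_less_power) auto
  then show ?thesis by (simp add: s'_def sum_negf)
qed

lemma DERIV_ln_s: "((\<lambda>z. ln (s z)) has_real_derivative s' u / s u) (at u)"
  using s_bounds(1)[of u] by (auto intro!: derivative_eq_intros DERIV_s)

lemma \<kappa>_eq: "\<kappa> u = - (s' u / s u)"
  using DERIV_ln_s by (simp add: kappa_eta_def DERIV_imp_deriv)

lemma \<kappa>_pos: "0 < \<kappa> u"
  using s'_neg s_bounds(1) by (simp add: \<kappa>_eq divide_neg_pos)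

lemma continuous_on_\<kappa>: "continuous_on X \<kappa>"
proof -
  have \<rho>c: "continuous_on UNIV (\<rho> i)" if "i \<in> {1..K}" for i
    using \<rho>_deriv[OF that] by (meson DERIV_isCont continuous_at_imp_continuous_on)
  have "continuous_on UNIV s'"
    unfolding s'_def[abs_def] by (intro continuous_intros \<rho>c \<rho>'_cont) auto
  moreover have "continuous_on UNIV s"
    using DERIV_s by (meson DERIV_isCont continuous_at_imp_continuous_on)
  ultimately have "continuous_on UNIV (\<lambda>u. - (s' u / s u))"
    using s_bounds(1) by (intro continuous_intros) (auto simp: less_imp_neq[symmetric])
  then show ?thesis
    unfolding \<kappa>_eq[abs_def] by (rule continuous_on_subset) simp
qed

text \<open>An antiderivative of \<open>\<kappa>\<close> is \<open>- ln s\<close>. The interval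
  integral is oriented, so the identity covers either order of the endpoints.\<close>

lemma integral_\<kappa>: "(LBINT z=a..y. \<kappa> z) = ln (s a) - ln (s y)"
proof -
  have "((\<lambda>z. - ln (s z)) has_vector_derivative \<kappa> z) (at z within X)" for z X
    using DERIV_minus[OF DERIV_ln_s[of z]]
    by (auto simp: \<kappa>_eq has_real_derivative_iff_has_vector_derivative
        intro: has_vector_derivative_at_within)
  then have "(LBINT z=a..y. \<kappa> z) = - ln (s y) - - ln (s a)"
    by (intro interval_integral_FTC_finite continuous_on_\<kappa>)
  then show ?thesis by simp
qed

lemma ln_ratio_eq:
  "ln ((1 - snd (F T)) / (1 - snd (S T))) = (\<Sum>t<T. LBINT z=fst (F t)..fst (P t). \<kappa> z)"
proof -
  have nonzero: "s u \<noteq> 0" for u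
    using s_bounds(1)[of u] by simp
  \<comment> \<open>The shared initial error \<open>1 - v0\<close> cancels because it is positive,
    leaving one quotient per round.\<close>
  have ratio: "(1 - snd (F T)) / (1 - snd (S T)) = (\<Prod>t<T. s (fst (F t)) / s (fst (P t)))"
    unfolding F_closed(2) S_closed prod_dividef using v0 by simp
  have "ln ((1 - snd (F T)) / (1 - snd (S T))) = (\<Sum>t<T. ln (s (fst (F t)) / s (fst (P t))))"
    unfolding ratio by (rule ln_prod) (simp_all add: nonzero)
  then show ?thesis
    by (simp only: integral_\<kappa> ln_div nonzero not_False_eq_True simp_thms if_True)
qed

end

section \<open>Instantiation with the normal link\<close>

theorem theorem1:
  fixes K E :: nat
    and w x h :: "nat \<Rightarrow> real"
    and b c u0 v0 lam \<eta> :: real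
    and \<rho> :: "nat \<Rightarrow> real \<Rightarrow> real"
    and L :: "nat \<Rightarrow> real \<times> real \<Rightarrow> real \<times> real \<Rightarrow> real"
    and F P S :: "nat \<Rightarrow> real \<times> real"
    and Loc :: "nat \<Rightarrow> nat \<Rightarrow> real \<times> real"
    and s \<kappa> :: "real \<Rightarrow> real"
  assumes "K \<ge> 1"
    and "\<And>i. i \<in> {1..K} \<Longrightarrow> w i > 0"
    and "(\<Sum>i=1..K. w i) = 1"
    and "\<And>i. i \<in> {1..K} \<Longrightarrow> x i > 0"
    and h: "h = (\<lambda>i. (x i)\<^sup>2)"
    and "u0 < c" and "c < b"
    and "0 \<le> v0" and "v0 < 1"
    and "lam > 0"
    and "E \<ge> 2"
    and "0 < \<eta> * Max (insert lam (h ` {1..K}))"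
    and "\<eta> * Max (insert lam (h ` {1..K})) < 1"
    and \<rho>: "\<rho> = (\<lambda>i u. std_normal_cdf (x i * (u - c)))"
    and L: "L = client_loss b lam h \<rho>"
    and F: "F = fedavg K w E \<eta> L (u0, v0)"
    and P: "P = pooled K w E \<eta> L (u0, v0)"
    and Loc: "Loc = local_process E \<eta> L (u0, v0)"
    and S: "S = source_swapped K w E \<eta> L (u0, v0)"
    and s: "s = s_eta K w E \<eta> lam \<rho>"
    and \<kappa>: "\<kappa> = kappa_eta K w E \<eta> lam \<rho>"
  shows
    "(\<forall>t. fst (F t) \<le> fst (P t) \<and> snd (F t) \<le> snd (P t))
   \<and> (\<forall>u. s u > 0 \<and> (\<lambda>z. ln (s z)) field_differentiable at u \<and> \<kappa> u > 0)
   \<and> (\<forall>T\<ge>1. snd (F T) \<le> snd (S T) \<and> snd (S T) \<le> snd (P T)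
        \<and> snd (F T) < 1 \<and> snd (S T) < 1
        \<and> (\<forall>t<T. interval_lebesgue_integrable lborel (fst (F t)) (fst (P t)) \<kappa>)
        \<and> ln ((1 - snd (F T)) / (1 - snd (S T)))
            = (\<Sum>t<T. LBINT z=fst (F t)..fst (P t). \<kappa> z))
   \<and> (\<forall>p :: nat \<Rightarrow> real. (\<forall>i\<in>{1..K}. 0 \<le> p i \<and> p i \<le> 1) \<longrightarrow>
        (\<forall>T. snd (fedavg K w E \<eta> (client_loss b lam h (\<lambda>i _. p i)) (u0, v0) T)
           = snd (source_swapped K w E \<eta> (client_loss b lam h (\<lambda>i _. p i)) (u0, v0) T)))
   \<and> (\<forall>i\<in>{1..K}. \<forall>\<phi> \<theta>. is_arg_min (L i \<phi>) (\<lambda>_. True) \<theta> \<longleftrightarrow> \<theta> = (b, 1))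
   \<and> F \<longlonglongrightarrow> (b, 1) \<and> incseq (\<lambda>t. fst (F t)) \<and> incseq (\<lambda>t. snd (F t))
   \<and> P \<longlonglongrightarrow> (b, 1) \<and> incseq (\<lambda>t. fst (P t)) \<and> incseq (\<lambda>t. snd (P t))
   \<and> (\<forall>i\<in>{1..K}. Loc i \<longlonglongrightarrow> (b, 1)
        \<and> incseq (\<lambda>t. fst (Loc i t)) \<and> incseq (\<lambda>t. snd (Loc i t)))"
proof -
  let ?M = "Max (insert lam (h ` {1..K}))"
  have le_M: "lam \<le> ?M" "\<And>i. i \<in> {1..K} \<Longrightarrow> h i \<le> ?M"
    by (intro Max_ge; simp)+
  \<comment> \<open>The maximum is at least \<open>lam > 0\<close>, so the positive product forces
    the sign of \<open>\<eta>\<close>.\<close>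
  then have \<eta>: "0 < \<eta>"
    using \<open>lam > 0\<close> \<open>0 < \<eta> * ?M\<close> by (auto simp: zero_less_mult_iff)
  have small: "\<eta> * y < 1" if "y \<le> ?M" for y
    using mult_left_mono[OF that, of \<eta>] \<eta> \<open>\<eta> * ?M < 1\<close> by linarith
  have h_pos: "0 < h i" if "i \<in> {1..K}" for i
    using assms(4)[OF that] by (simp add: h)
  \<comment> \<open>The chain rule supplies the factor \<open>x i\<close>, whose positivity makes
    each \<open>\<rho> i\<close> increasing.\<close>
  interpret feature_federation K E w h b lam \<eta> \<rho> "\<lambda>i u. std_normal_density (x i * (u - c)) * x i" u0 v0
  proof unfold_locales
    show "\<eta> * lam < 1" using small le_M(1) .
    show "E \<ge> 1" "u0 < b"
      using \<open>E \<ge> 2\<close> \<open>u0 < c\<close> \<open>c < b\<close> by simp_all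
  next
    fix i u assume i: "i \<in> {1..K}"
    show "\<eta> * h i < 1" using small le_M(2)[OF i] .
    show "(\<rho> i has_real_derivative std_normal_density (x i * (u - c)) * x i) (at u)"
      unfolding \<rho>
      by (rule DERIV_chain2[OF DERIV_std_normal_cdf]) (auto intro!: derivative_eq_intros)
    show "0 < std_normal_density (x i * (u - c)) * x i"
      using assms(4)[OF i] by (simp add: normal_density_pos)
    show "continuous_on UNIV (\<lambda>u. std_normal_density (x i * (u - c)) * x i)"
      unfolding std_normal_density_def by (intro continuous_intros) auto
    show "0 < \<rho> i u" "\<rho> i u \<le> 1"
      by (simp_all add: \<rho> std_normal_cdf_pos std_normal_cdf_le_1)
  qed (fact \<eta> h_pos assms)+
  \<comment> \<open>Integrability here and differentiability below ensure that the integral and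
    \<open>deriv\<close> are not default values.\<close>
  have "interval_lebesgue_integrable lborel (fst (F t)) (fst (P t)) \<kappa>" for t
    unfolding F P L \<kappa> using fst_F_le_P continuous_on_\<kappa> by (rule interval_integrable_continuous_on)
  moreover have "(\<lambda>z. ln (s z)) field_differentiable at u" for u
    unfolding s using DERIV_ln_s by (auto simp: field_differentiable_def)
  moreover have "is_arg_min (L i \<phi>) (\<lambda>_. True) \<theta> \<longleftrightarrow> \<theta> = (b, 1)" if "i \<in> {1..K}" for i \<phi> \<theta>
    unfolding L using that h_pos lam(1) \<rho>_pos by (intro is_arg_min_client_loss) auto
  \<comment> \<open>The swapped process is the intermediate term: first change the source, then the
    order of averaging.\<close>
  moreover have "snd (F t) \<le> snd (P t)" for t
    unfolding F P L using snd_F_le_S snd_S_le_P by (rule order_trans)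
  ultimately show ?thesis
    using fst_F_le_P s_bounds(1) \<kappa>_pos snd_F_le_S snd_S_le_P snd_less_1 ln_ratio_eq
      fedavg_eq_source_swapped_const F_converges P_converges Loc_converges
    unfolding F P S Loc L s \<kappa> by (intro conjI allI impI ballI) (assumption | simp)+
qed

end
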